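(* Let $(N,A,c)$ be an axes-cutting public bads instance and let $x\in\Delta(A)$ be proportionally fair with $c_i(x)>0$ for all $i\in N$. Then $x$ satisfies strong individual fair share and $x$ is in the completion core.
   Context: A public bads instance $(N,A,c)$ consists of agents $N=\{1,\dots,n\}$, a finite set $A$ of alternatives (bads), and cost functions $c_i:A\to\mathbb{R}_{\ge 0}$, $i\in N$. $\Delta(A)$ is the set of lotteries (probability vectors) on $A$; $c_i(x)=\sum_{a\in A}x(a)c_i(a)$ and $c(x)=(c_i(x))_{i\in N}$. Standing assumptions: $0\notin\{c(x):x\in\Delta(A)\}$, and for every $i\in N$ there is $a\in A$ with $c_i(a)<\max_{a'\in A}c_i(a')$. The instance is axes-cutting if for every $i\in N$ there is $a_i\in A$ with $c_i(a_i)>0$ and $c_{i'}(a_i)=0$ for all $i'\in N\setminus\{i\}$. Proportional fairness: $x\in\Delta(A)$ is proportionally fair if $\frac1n\sum_{i\in N}\frac{c_i(y)}{c_i(x)}\ge 1$ for all $y\in\Delta(A)$, with conventions $0/0=1$ and $\alpha/0=+\infty$ for $\alpha>0$. Strong individual fair share (sIFS): with $c_i^{\max}=\max_{a\in A}c_i(a)$ and $c_i^{\min}=\min_{a\in A}c_i(a)$, $x$ satisfies sIFS if $c_i(x)\le\frac{n-1}{n}c_i^{\min}+\frac1n c_i^{\max}$ for all $i\in N$. Completion core: $x$ is in the completion core if there exist no $S\subseteq N$ and $y\in\Delta(A)$ such that $\frac{|S|}{n}c_i(y)+\frac{n-|S|}{n}\max_{a\in A}c_i(a)\le c_i(x)$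 for every $i\in S$, with at least one of these inequalities strict. *)

theory Defs
  imports "HOL-Analysis.Analysis"
begin

text \<open>Agents are \<open>{1..n}\<close>; the cost functions are \<open>c :: nat \<Rightarrow> 'a \<Rightarrow> real\<close>,
  constrained only on \<open>{1..n}\<close> and \<open>A\<close>.\<close>

text \<open>Lotteries are extended by \<open>0\<close> outside \<open>A\<close>, so that each probability vector on \<open>A\<close>
  has a unique representative.\<close>

definition lotteries :: "'a set \<Rightarrow> ('a \<Rightarrow> real) set" where
  "lotteries A = {x. (\<forall>a\<in>A. 0 \<le> x a) \<and> (\<forall>a. a \<notin> A \<longrightarrow> x a = 0) \<and> (\<Sum>a\<in>A. x a) = 1}"

definition exp_cost :: "'a set \<Rightarrow> ('a \<Rightarrow> real) \<Rightarrow> ('a \<Rightarrow> real) \<Rightarrow> real" where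
  "exp_cost A ci x = (\<Sum>a\<in>A. x a * ci a)"

text \<open>The last two conjuncts are the standing assumptions: the zero vector is not an attainable
  cost profile, and no agent has a constant cost function.\<close>

definition public_bads_instance :: "nat \<Rightarrow> 'a set \<Rightarrow> (nat \<Rightarrow> 'a \<Rightarrow> real) \<Rightarrow> bool" where
  "public_bads_instance n A c \<longleftrightarrow>
     n \<ge> 1 \<and> finite A \<and> A \<noteq> {} \<and>
     (\<forall>i\<in>{1..n}. \<forall>a\<in>A. 0 \<le> c i a) \<and>
     \<not> (\<exists>x\<in>lotteries A. \<forall>i\<in>{1..n}. exp_cost A (c i) x = 0) \<and>
     (\<forall>i\<in>{1..n}. \<exists>a\<in>A. c i a < (MAX a'\<in>A. c i a'))"

definition axes_cutting :: "nat \<Rightarrow> 'a set \<Rightarrow> (nat \<Rightarrow> 'a \<Rightarrow> real) \<Rightarrow> bool" where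
  "axes_cutting n A c \<longleftrightarrow>
     (\<forall>i\<in>{1..n}. \<exists>a\<in>A. c i a > 0 \<and> (\<forall>i'\<in>{1..n} - {i}. c i' a = 0))"

text \<open>Ratio of nonnegative reals with \<open>0/0 = 1\<close> and \<open>\<alpha>/0 = \<infinity>\<close> for \<open>\<alpha> > 0\<close>; the
  library division on \<^typ>\<open>ereal\<close> has \<open>0/0 = 0\<close>.\<close>

definition cost_ratio :: "real \<Rightarrow> real \<Rightarrow> ereal" where
  "cost_ratio \<alpha> \<beta> = (if \<beta> = 0 then (if \<alpha> = 0 then 1 else \<infinity>) else ereal (\<alpha> / \<beta>))"

definition proportionally_fair ::
    "nat \<Rightarrow> 'a set \<Rightarrow> (nat \<Rightarrow> 'a \<Rightarrow> real) \<Rightarrow> ('a \<Rightarrow> real) \<Rightarrow> bool" where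
  "proportionally_fair n A c x \<longleftrightarrow>
     (\<forall>y\<in>lotteries A.
        ereal (1 / real n) * (\<Sum>i\<in>{1..n}. cost_ratio (exp_cost A (c i) y) (exp_cost A (c i) x)) \<ge> 1)"

definition strong_IFS ::
    "nat \<Rightarrow> 'a set \<Rightarrow> (nat \<Rightarrow> 'a \<Rightarrow> real) \<Rightarrow> ('a \<Rightarrow> real) \<Rightarrow> bool" where
  "strong_IFS n A c x \<longleftrightarrow>
     (\<forall>i\<in>{1..n}. exp_cost A (c i) x
        \<le> (real n - 1) / real n * (MIN a\<in>A. c i a) + 1 / real n * (MAX a\<in>A. c i a))"

definition completion_cost ::
    "nat \<Rightarrow> 'a set \<Rightarrow> (nat \<Rightarrow> 'a \<Rightarrow> real) \<Rightarrow> nat set \<Rightarrow> ('a \<Rightarrow> real) \<Rightarrow> nat \<Rightarrow> real" where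
  "completion_cost n A c S y i =
     real (card S) / real n * exp_cost A (c i) y
     + (real n - real (card S)) / real n * (MAX a\<in>A. c i a)"

definition in_completion_core ::
    "nat \<Rightarrow> 'a set \<Rightarrow> (nat \<Rightarrow> 'a \<Rightarrow> real) \<Rightarrow> ('a \<Rightarrow> real) \<Rightarrow> bool" where
  "in_completion_core n A c x \<longleftrightarrow>
     \<not> (\<exists>S y. S \<subseteq> {1..n} \<and> y \<in> lotteries A \<and>
          (\<forall>i\<in>S. completion_cost n A c S y i \<le> exp_cost A (c i) x) \<and>
          (\<exists>i\<in>S. completion_cost n A c S y i < exp_cost A (c i) x))"

end

theory Submission
  imports Defs
begin

text \<open>Comparing \<open>x\<close> with the degenerate lottery on the bad \<open>a\<^sub>i\<close> that hurts only agent \<open>i\<close>,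
  proportional fairness gives \<open>c\<^sub>i(x) \<le> c\<^sub>i(a\<^sub>i) / n \<le> c\<^sub>i\<^sup>m\<^sup>a\<^sup>x / n\<close>, hence strong individual fair share.
  If a coalition \<open>S\<close> of size \<open>s\<close> blocks via \<open>y\<close> and \<open>i \<in> S\<close> gains strictly, this bound yields
  \<open>0 \<le> (s/n) c\<^sub>i(y) < (1 - (n - s)) c\<^sub>i(x)\<close>, so \<open>S\<close> is the whole agent set; then
  \<open>y\<close> Pareto improves on \<open>x\<close>, contradicting proportional fairness.\<close>

lemma indicator_in_lotteries:
  assumes "finite A" "a \<in> A"
  shows "(\<lambda>b. if b = a then 1 else 0) \<in> lotteries A"
  using assms by (auto simp: lotteries_def)

lemma exp_cost_indicator:
  assumes "finite A" "a \<in> A"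
  shows "exp_cost A f (\<lambda>b. if b = a then 1 else 0) = f a"
proof -
  have "exp_cost A f (\<lambda>b. if b = a then 1 else 0) = (\<Sum>b\<in>A. if b = a then f b else 0)"
    unfolding exp_cost_def by (intro sum.cong) auto
  then show ?thesis
    using assms by simp
qed

lemma exp_cost_nonneg:
  assumes "y \<in> lotteries A" "\<And>a. a \<in> A \<Longrightarrow> 0 \<le> f a"
  shows "0 \<le> exp_cost A f y"
  using assms by (auto simp: exp_cost_def lotteries_def intro!: sum_nonneg)

text \<open>Every denominator is positive, so neither convention in \<open>cost_ratio\<close>
  applies: the extended-real condition becomes a real inequality, and multiplying by
  \<open>n\<close> clears the average.\<close>

lemma proportionally_fair_sum_ge:
  assumes "proportionally_fair n A c x" "y \<in> lotteries A" "n \<ge> 1"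
    and pos: "\<And>i. i \<in> {1..n} \<Longrightarrow> exp_cost A (c i) x > 0"
  shows "(\<Sum>i\<in>{1..n}. exp_cost A (c i) y / exp_cost A (c i) x) \<ge> real n"
proof -
  have "(\<Sum>i\<in>{1..n}. cost_ratio (exp_cost A (c i) y) (exp_cost A (c i) x))
      = (\<Sum>i\<in>{1..n}. ereal (exp_cost A (c i) y / exp_cost A (c i) x))"
    using pos by (intro sum.cong) (force simp: cost_ratio_def)+
  then have "1 / real n * (\<Sum>i\<in>{1..n}. exp_cost A (c i) y / exp_cost A (c i) x) \<ge> 1"
    using assms(1,2) by (auto simp: proportionally_fair_def one_ereal_def)
  then show ?thesis
    using \<open>n \<ge> 1\<close> by (simp add: field_simps)
qed

text \<open>Against the degenerate lottery on the bad that costs only agent \<open>i\<close>, all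
  other ratios vanish, so the ratio of \<open>i\<close> alone must reach \<open>n\<close>.\<close>

lemma axes_cutting_cost_le:
  assumes inst: "public_bads_instance n A c" and "axes_cutting n A c"
    and pf: "proportionally_fair n A c x"
    and pos: "\<And>i. i \<in> {1..n} \<Longrightarrow> exp_cost A (c i) x > 0"
    and i: "i \<in> {1..n}"
  shows "real n * exp_cost A (c i) x \<le> (MAX a\<in>A. c i a)"
proof -
  have fin: "finite A" and n: "n \<ge> 1"
    using inst by (auto simp: public_bads_instance_def)
  obtain a where a: "a \<in> A" "\<forall>j\<in>{1..n} - {i}. c j a = 0"
    using \<open>axes_cutting n A c\<close> i unfolding axes_cutting_def by blast
  have "real n \<le> (\<Sum>j\<in>{1..n}. c j a / exp_cost A (c j) x)"
    using proportionally_fair_sum_ge[OF pf indicator_in_lotteries[OF fin a(1)] n pos]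
    by (simp add: exp_cost_indicator[OF fin a(1)])
  also have "\<dots> = c i a / exp_cost A (c i) x"
    using a(2) i by (subst sum.remove[of _ i]) auto
  finally have "real n * exp_cost A (c i) x \<le> c i a"
    using pos[OF i] by (simp add: field_simps)
  also have "\<dots> \<le> (MAX a\<in>A. c i a)"
    using fin a(1) by simp
  finally show ?thesis .
qed

text \<open>A Pareto improvement keeps every ratio at most 1 and pushes one below 1, so the ratios
  would sum to less than \<open>n\<close>.\<close>

lemma proportionally_fair_not_Pareto_dominated:
  assumes pf: "proportionally_fair n A c x" and y: "y \<in> lotteries A"
    and pos: "\<And>i. i \<in> {1..n} \<Longrightarrow> exp_cost A (c i) x > 0"
    and le: "\<And>i. i \<in> {1..n} \<Longrightarrow> exp_cost A (c i) y \<le> exp_cost A (c i) x"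
    and k: "k \<in> {1..n}"
  shows "exp_cost A (c k) y = exp_cost A (c k) x"
proof (rule ccontr)
  assume "exp_cost A (c k) y \<noteq> exp_cost A (c k) x"
  with le[OF k] have "exp_cost A (c k) y < exp_cost A (c k) x"
    by simp
  then have "(\<Sum>i\<in>{1..n}. exp_cost A (c i) y / exp_cost A (c i) x) < (\<Sum>i\<in>{1..n}. 1)"
    using pos le k by (intro sum_strict_mono_ex1) (auto intro!: bexI[of _ k])
  moreover have "real n \<le> (\<Sum>i\<in>{1..n}. exp_cost A (c i) y / exp_cost A (c i) x)"
    using k by (intro proportionally_fair_sum_ge[OF pf y _ pos]) auto
  ultimately show False
    by simp
qed

theorem theorem4p22:
  fixes n :: nat and A :: "'a set" and c :: "nat \<Rightarrow> 'a \<Rightarrow> real" and x :: "'a \<Rightarrow> real"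
  assumes "public_bads_instance n A c"
    and "axes_cutting n A c"
    and "x \<in> lotteries A"
    and "proportionally_fair n A c x"
    and "\<And>i. i \<in> {1..n} \<Longrightarrow> exp_cost A (c i) x > 0"
  shows "strong_IFS n A c x \<and> in_completion_core n A c x"
proof
  note pos = assms(5)
  have fin: "finite A" "A \<noteq> {}" and n: "n \<ge> 1"
    and nonneg: "\<And>i a. i \<in> {1..n} \<Longrightarrow> a \<in> A \<Longrightarrow> 0 \<le> c i a"
    using assms(1) by (auto simp: public_bads_instance_def)
  have bound: "real n * exp_cost A (c i) x \<le> (MAX a\<in>A. c i a)" if "i \<in> {1..n}" for i
    using axes_cutting_cost_le[OF assms(1,2,4) pos that] .
  show "strong_IFS n A c x"
    unfolding strong_IFS_def
  proof
    fix i assume i: "i \<in> {1..n}"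
    \<comment> \<open>The minimum only adds slack: the bound already gives one \<open>n\<close>-th
      of the maximum.\<close>
    have "0 \<le> (MIN a\<in>A. c i a)"
      using fin nonneg[OF i] by simp
    then have "0 \<le> (real n - 1) / real n * (MIN a\<in>A. c i a)"
      using n by simp
    moreover have "exp_cost A (c i) x \<le> 1 / real n * (MAX a\<in>A. c i a)"
      using bound[OF i] n by (simp add: field_simps)
    ultimately show "exp_cost A (c i) x
        \<le> (real n - 1) / real n * (MIN a\<in>A. c i a) + 1 / real n * (MAX a\<in>A. c i a)"
      by linarith
  qed
  show "in_completion_core n A c x"
    unfolding in_completion_core_def
  proof
    assume "\<exists>S y. S \<subseteq> {1..n} \<and> y \<in> lotteries A \<and>
          (\<forall>i\<in>S. completion_cost n A c S y i \<le> exp_cost A (c i) x) \<and>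
          (\<exists>i\<in>S. completion_cost n A c S y i < exp_cost A (c i) x)"
    then obtain S y k where S: "S \<subseteq> {1..n}" and y: "y \<in> lotteries A"
      and weak: "\<And>i. i \<in> S \<Longrightarrow> completion_cost n A c S y i \<le> exp_cost A (c i) x"
      and k: "k \<in> S" "completion_cost n A c S y k < exp_cost A (c k) x"
      by blast
    have kn: "k \<in> {1..n}"
      using S k by blast
    \<comment> \<open>The number of agents outside \<open>S\<close>, taken as a real so that the
      subtraction is not truncated.\<close>
    define t where "t = real n - real (card S)"
    have card_le: "card S \<le> n"
      using card_mono[OF _ S] by simp
    then have "0 \<le> t / real n"
      by (simp add: t_def)
    \<comment> \<open>Scaling \<open>bound\<close> by \<open>t / n\<close> shows that the completion
      term of \<open>k\<close> is at least \<open>t\<close> times the cost of \<open>k\<close> under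
      \<open>x\<close>.\<close>
    then have "t / real n * (real n * exp_cost A (c k) x) \<le> t / real n * (MAX a\<in>A. c k a)"
      by (intro mult_left_mono bound kn)
    moreover have "0 \<le> real (card S) / real n * exp_cost A (c k) y"
      using exp_cost_nonneg[OF y nonneg[OF kn]] by simp
    ultimately have "t * exp_cost A (c k) x < 1 * exp_cost A (c k) x"
      using k(2) n unfolding completion_cost_def t_def[symmetric] by simp
    then have "t < 1"
      using pos[OF kn] by (simp only: mult_less_cancel_right_pos)
    \<comment> \<open>Since \<open>t\<close> is a difference of natural numbers and nonnegative,
      \<open>t < 1\<close> forces \<open>t = 0\<close>.\<close>
    then have "card S = n"
      using card_le by (simp add: t_def)
    then have SN: "S = {1..n}"
      using S by (intro card_subset_eq) auto
    \<comment> \<open>For the grand coalition the weight of the maximum is 0, so blocking is plain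
      Pareto domination.\<close>
    have cost: "completion_cost n A c S y i = exp_cost A (c i) y" for i
      using n \<open>card S = n\<close> by (simp add: completion_cost_def)
    have "exp_cost A (c i) y \<le> exp_cost A (c i) x" if "i \<in> {1..n}" for i
      using weak[unfolded cost] that SN by blast
    then have "exp_cost A (c k) y = exp_cost A (c k) x"
      by (intro proportionally_fair_not_Pareto_dominated[OF assms(4) y pos _ kn])
    then show False
      using k(2) by (simp add: cost)
  qed
qed

end
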